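(* Assume (UE) and (ME). Then for every $x\in E$ $$\sup_{u\in\mathcal U}\sup_{B\in\mathcal E}|\lambda_x^{u,\alpha}(B)-\pi^u(B)|\to 0\quad\text{as }\alpha\to0 .$$
   Context: $E$ is a Polish space with Borel $\sigma$-field $\mathcal E$; $U$ is a compact set of control parameters; $\mathcal U$ is a family of Borel measurable mappings $u:E\to U$ (Markov controls). For $a\in U$, $P^a(x,\cdot)$ denotes the transition kernel on $E$ under constant control $a$. For each $u\in\mathcal U$, $(X_t^u)_{t=0,1,2,\dots}$ is the discrete-time Markov process on $E$ with transition kernel $P^{u(x)}(x,dy)$ (assumed to be a Markov kernel), $(P^u)^n$ is the $n$-th iterate of this kernel, and $E_x^u$ is expectation when the process starts at $x$. (UE): $\ \sup_{x,x'\in E}\sup_{a,a'\in U}\sup_{B\in\mathcal E}\big(P^a(x,B)-P^{a'}(x',B)\big)=:\Delta<1$. Under (UE), each $u\in\mathcal U$ has a unique invariant probability measure $\pi^u$ for the kernel $P^{u(x)}(x,dy)$, and $\sup_{B\in\mathcal E}|(P^u)^n(x,B)-\pi^u(B)|\le\Delta^n$ for all $x\in E$, $n\ge1$. (ME): there is an integer $m\ge1$ such that $\sup_{x,x'\in E}\sup_{u\in\mathcal U}\sup_{B\in\mathcal E}\frac{(P^u)^m(x,B)}{(P^u)^m(x',B)}=:K<\infty$; that is, $(P^u)^m(x,B)\le K\,(P^u)^m(x',B)$ for all $x,x'\in E$, $u\in\mathcal U$, $B\in\mathcal E$. For $\alpha\in\mathbb R\setminus\{0\}$ and $B\in\mathcal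 E$, $$\lambda_x^{u,\alpha}(B)=\liminf_{n\to\infty}\frac1{\alpha n}\ln E_x^u\Big\{e^{\alpha\sum_{i=0}^{n-1}1_B(X_i^u)}\Big\}.$$ *)

theory Defs
  imports "HOL-Probability.Probability"
begin

text \<open>A kernel on \<open>E\<close> is a map \<open>K :: 'e \<Rightarrow> 'e measure\<close>; it is Markov if it is measurable into the
  Giry monad of probability measures.\<close>

definition markov_kernel :: "('e::topological_space \<Rightarrow> 'e measure) \<Rightarrow> bool" where
  "markov_kernel K \<longleftrightarrow> K \<in> borel \<rightarrow>\<^sub>M prob_algebra borel"

definition controlled_kernel :: "('c \<Rightarrow> 'e \<Rightarrow> 'e measure) \<Rightarrow> ('e \<Rightarrow> 'c) \<Rightarrow> 'e \<Rightarrow> 'e measure" where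
  "controlled_kernel P u = (\<lambda>x. P (u x) x)"

primrec kernel_power :: "('e::topological_space \<Rightarrow> 'e measure) \<Rightarrow> nat \<Rightarrow> 'e \<Rightarrow> 'e measure" where
  "kernel_power K 0 = (\<lambda>x. return borel x)"
| "kernel_power K (Suc n) = (\<lambda>x. kernel_power K n x \<bind> K)"

definition invariant_prob :: "('e::topological_space \<Rightarrow> 'e measure) \<Rightarrow> 'e measure \<Rightarrow> bool" where
  "invariant_prob K \<mu> \<longleftrightarrow> \<mu> \<in> space (prob_algebra borel) \<and> \<mu> \<bind> K = \<mu>"

text \<open>Only meaningful for kernels with exactly one invariant probability measure.\<close>

definition invariant_measure :: "('e::topological_space \<Rightarrow> 'e measure) \<Rightarrow> 'e measure" where
  "invariant_measure K = (THE \<mu>. invariant_prob K \<mu>)"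

text \<open>The law of the Markov process with kernel \<open>K\<close> started at \<open>x\<close>, on the path space \<open>nat \<Rightarrow> 'e\<close>, by
  the Ionescu-Tulcea theorem: the initial coordinate is \<open>x\<close>, and given the path \<open>\<omega>\<close> up to time \<open>n\<close>
  the next coordinate has law \<open>K (\<omega> n)\<close>. The process itself is the coordinate process
  \<open>X\<^sub>n \<omega> = \<omega> n\<close>.\<close>

definition path_step ::
  "('e::topological_space \<Rightarrow> 'e measure) \<Rightarrow> 'e \<Rightarrow> nat \<Rightarrow> (nat \<Rightarrow> 'e) \<Rightarrow> 'e measure" where
  "path_step K x i \<omega> = (case i of 0 \<Rightarrow> return borel x | Suc n \<Rightarrow> K (\<omega> n))"

definition path_measure :: "('e::topological_space \<Rightarrow> 'e measure) \<Rightarrow> 'e \<Rightarrow> (nat \<Rightarrow> 'e) measure" where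
  "path_measure K x =
     projective_family.lim UNIV (Ionescu_Tulcea.CI (path_step K x) (\<lambda>_. borel)) (\<lambda>_. borel)"

lemma Ionescu_Tulcea_path_step:
  fixes K :: "'e::topological_space \<Rightarrow> 'e measure"
  assumes "markov_kernel K"
  shows "Ionescu_Tulcea (path_step K x) (\<lambda>_. borel)"
proof (rule Ionescu_Tulcea.intro)
  have K: "K \<in> borel \<rightarrow>\<^sub>M prob_algebra borel"
    using assms by (simp add: markov_kernel_def)
  fix i
  show "path_step K x i \<in> PiM {0..<i} (\<lambda>_. borel) \<rightarrow>\<^sub>M subprob_algebra borel"
  proof (cases i)
    case 0
    then show ?thesis
      unfolding path_step_def by (simp add: space_subprob_algebra prob_space_return prob_space_imp_subprob_space)
  next
    case (Suc n)
    have "(\<lambda>\<omega>. K (\<omega> n)) \<in> PiM {0..<Suc n} (\<lambda>_. borel) \<rightarrow>\<^sub>M subprob_algebra borel"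
      by (rule measurable_compose[where f = "\<lambda>\<omega>. \<omega> n", OF _ measurable_prob_algebraD[OF K]])
        (rule measurable_component_singleton, simp)
    then show ?thesis
      using Suc by (simp add: path_step_def[abs_def])
  qed
  fix \<omega> :: "nat \<Rightarrow> 'e"
  assume "\<omega> \<in> space (PiM {0..<i} (\<lambda>_. borel :: 'e measure))"
  show "prob_space (path_step K x i \<omega>)"
    using measurable_space[OF K]
    by (auto simp: path_step_def space_prob_algebra prob_space_return split: nat.split)
qed

text \<open>The quantity under the logarithm is a real number in \<open>[min 1 (exp (\<alpha> n)), max 1 (exp (\<alpha> n))]\<close>;
  the limit inferior is taken in the extended reals. The term \<open>n = 0\<close>, where the divisor vanishes,
  does not affect it.\<close>

definition occupation_growth ::
  "('e::topological_space \<Rightarrow> 'e measure) \<Rightarrow> real \<Rightarrow> 'e \<Rightarrow> 'e set \<Rightarrow> ereal" where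
  "occupation_growth K \<alpha> x B =
     liminf (\<lambda>n. ereal (1 / (\<alpha> * real n) *
       ln (\<integral>\<omega>. exp (\<alpha> * (\<Sum>i<n. indicator B (\<omega> i))) \<partial>path_measure K x)))"

definition uniform_ergodic ::
  "'c set \<Rightarrow> ('c \<Rightarrow> 'e::topological_space \<Rightarrow> 'e measure) \<Rightarrow> bool" where
  "uniform_ergodic U P \<longleftrightarrow>
     (SUP x. SUP x'. SUP a\<in>U. SUP a'\<in>U. SUP B\<in>sets borel.
        ereal (measure (P a x) B - measure (P a' x') B)) < 1"

text \<open>In \<^typ>\<open>ennreal\<close> we have \<open>0 / 0 = 0\<close> and \<open>a / 0 = \<infinity>\<close> for \<open>a > 0\<close>, so that the supremum of
  the quotients bounds the numerator by a multiple of the denominator also when the latter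
  vanishes; see \<open>mixing_ergodic_iff\<close>.\<close>

definition mixing_ergodic ::
  "('e::topological_space \<Rightarrow> 'c) set \<Rightarrow> ('c \<Rightarrow> 'e \<Rightarrow> 'e measure) \<Rightarrow> bool" where
  "mixing_ergodic \<U> P \<longleftrightarrow>
     (\<exists>m\<ge>1. (SUP x. SUP x'. SUP u\<in>\<U>. SUP B\<in>sets borel.
        emeasure (kernel_power (controlled_kernel P u) m x) B /
        emeasure (kernel_power (controlled_kernel P u) m x') B) < \<infinity>)"

lemma kernel_power_prob_algebra:
  assumes "markov_kernel K"
  shows "kernel_power K n \<in> borel \<rightarrow>\<^sub>M prob_algebra borel"
proof (induction n)
  case 0
  then show ?case
    by (simp add: measurable_return_prob_space)
next
  case (Suc n)
  then show ?case
    using assms by (auto simp: markov_kernel_def intro: measurable_bind_prob_space)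
qed

lemma ennreal_divide_le_iff:
  assumes "0 \<le> a" "0 \<le> b" "0 \<le> k"
  shows "ennreal a / ennreal b \<le> ennreal k \<longleftrightarrow> a \<le> k * b"
proof (cases "b = 0")
  case True
  then show ?thesis
    using assms by (auto simp: top_unique)
next
  case False
  then show ?thesis
    using assms by (simp add: divide_ennreal pos_divide_le_eq)
qed

lemma mixing_ergodic_iff:
  assumes "\<And>u. u \<in> \<U> \<Longrightarrow> markov_kernel (controlled_kernel P u)"
  shows "mixing_ergodic \<U> P \<longleftrightarrow>
    (\<exists>m\<ge>1. \<exists>K::real. \<forall>x x'. \<forall>u\<in>\<U>. \<forall>B\<in>sets borel.
       measure (kernel_power (controlled_kernel P u) m x) B \<le>
       K * measure (kernel_power (controlled_kernel P u) m x') B)"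
proof -
  let ?k = "\<lambda>u m x. kernel_power (controlled_kernel P u) m x"
  have em: "emeasure (?k u m x) B = ennreal (measure (?k u m x) B)" if "u \<in> \<U>" for u m x B
  proof -
    have "prob_space (?k u m x)"
      using measurable_space[OF kernel_power_prob_algebra[OF assms[OF that]], of x m]
      by (auto simp: space_prob_algebra)
    then interpret prob_space "?k u m x" .
    show ?thesis by (rule emeasure_eq_measure)
  qed
  have "(SUP x. SUP x'. SUP u\<in>\<U>. SUP B\<in>sets borel. emeasure (?k u m x) B / emeasure (?k u m x') B) < \<infinity>
      \<longleftrightarrow> (\<exists>K::real. \<forall>x x'. \<forall>u\<in>\<U>. \<forall>B\<in>sets borel. measure (?k u m x) B \<le> K * measure (?k u m x') B)"
    (is "?S < \<infinity> \<longleftrightarrow> ?R") for m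
  proof -
    have le: "?S \<le> ennreal K \<longleftrightarrow> (\<forall>x x'. \<forall>u\<in>\<U>. \<forall>B\<in>sets borel. measure (?k u m x) B \<le> K * measure (?k u m x') B)"
      if "0 \<le> K" for K
      using that by (simp add: SUP_le_iff em ennreal_divide_le_iff)
    show ?thesis
    proof
      assume "?S < \<infinity>"
      then obtain K where "0 \<le> K" "?S = ennreal K"
        by (cases ?S) auto
      then have "?S \<le> ennreal K" by simp
      then show ?R
        unfolding le[OF \<open>0 \<le> K\<close>] by (rule exI)
    next
      assume ?R
      then obtain K where K: "\<And>x x' u B. u \<in> \<U> \<Longrightarrow> B \<in> sets borel \<Longrightarrow>
          measure (?k u m x) B \<le> K * measure (?k u m x') B"
        by blast
      have "measure (?k u m x) B \<le> max 0 K * measure (?k u m x') B" if "u \<in> \<U>" "B \<in> sets borel" for x x' u B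
        using K[OF that, of x x'] mult_right_mono[of K "max 0 K" "measure (?k u m x') B"] by simp
      then have "?S \<le> ennreal (max 0 K)"
        by (subst le) auto
      then show "?S < \<infinity>"
        by (rule order.strict_trans1) simp
    qed
  qed
  then show ?thesis
    by (simp add: mixing_ergodic_def)
qed

end

(*
  Write f = 1_B - pi(B) and let h be the sum of (P^k f) over k < N, so that f - (h - P h) = P^N f is
  at most Delta^N in absolute value. A second order expansion of the exponential gives
  P (exp (alpha h)) = exp (alpha P h + O(alpha^2 N^2)), so that
  exp (alpha (f(X_0) + ... + f(X_{n-1})) + alpha h(X_n)) is a martingale up to a factor
  exp (O(|alpha| Delta^N + alpha^2 N^2)) per step. As h is bounded by N, the growth rate differs
  from pi(B) by O(Delta^N + |alpha| N^2), uniformly in B, the control and the starting point: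
  choose first N large and then alpha small. The bound |P^N f| <= Delta^N, and the existence and
  uniqueness of pi, come from the contraction of total variation by Delta under one step of P.
*)
theory Submission
  imports Defs
begin

section \<open>Total variation and exponential moments\<close>

lemma sum_indicator_eq_floor:
  fixes z :: real
  assumes "0 \<le> z" "z \<le> real n"
  shows "(\<Sum>k=1..n. indicator {t. real k \<le> t} z) = real_of_int \<lfloor>z\<rfloor>"
proof -
  have "{k \<in> {1..n}. real k \<le> z} = {1..nat \<lfloor>z\<rfloor>}"
    using assms by (auto simp: le_nat_iff le_floor_iff)
  moreover have "(\<Sum>k=1..n. indicator {t. real k \<le> t} z :: real) = real (card {k \<in> {1..n}. real k \<le> z})"
    by (simp add: indicator_def sum.If_cases Int_def)
  ultimately show ?thesis
    using assms by simp
qed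

text \<open>Round \<open>g\<close> down to a grid of mesh \<open>D / n\<close>. The rounded function
  is \<open>a\<close> plus \<open>D / n\<close> times a sum of indicators of \<open>n\<close>
  superlevel sets, and each of these contributes at most \<open>d\<close> to the difference. Only
  the oscillation \<open>D\<close> of \<open>g\<close> enters, so that (UE) later yields a
  contraction by \<open>\<Delta>\<close> without an extra factor.\<close>

lemma integral_diff_le_of_measure_diff_le:
  assumes M: "prob_space M" and N: "prob_space N" and sets_eq: "sets N = sets M"
    and tv: "\<And>A. A \<in> sets M \<Longrightarrow> measure M A - measure N A \<le> d"
    and g[measurable]: "g \<in> borel_measurable M"
    and bnd: "\<And>x. x \<in> space M \<Longrightarrow> a \<le> g x \<and> g x \<le> a + D"
    and D: "0 \<le> D"
  shows "(\<integral>x. g x \<partial>M) - (\<integral>x. g x \<partial>N) \<le> d * D"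
\<comment> \<open>The level sets below divide by \<open>D\<close>; for \<open>D = 0\<close> both
  integrals equal \<open>a\<close>.\<close>
proof (cases "D = 0")
  case True
  interpret M: prob_space M by fact
  interpret N: prob_space N by fact
  have sp: "space N = space M" by (rule sets_eq_imp_space_eq) fact
  have "(\<integral>x. g x \<partial>M) = (\<integral>x. a \<partial>M)" using bnd True by (intro Bochner_Integration.integral_cong) force+
  moreover have "(\<integral>x. g x \<partial>N) = (\<integral>x. a \<partial>N)" using bnd True sp by (intro Bochner_Integration.integral_cong) force+
  ultimately show ?thesis using True by (simp add: M.prob_space N.prob_space)
next
  case False
  with D have D: "0 < D" by simp
  interpret M: prob_space M by fact
  interpret N: prob_space N by fact
  have sp: "space N = space M" by (rule sets_eq_imp_space_eq) fact
  note [measurable_cong] = sets_eq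
  have gN[measurable]: "g \<in> borel_measurable N" by simp
  have iM: "integrable M g" using bnd
    by (intro M.integrable_const_bound[of _ "\<bar>a\<bar> + \<bar>D\<bar>"]) (auto intro!: AE_I2 simp: abs_le_iff dest!: bnd)
  have iN: "integrable N g" using bnd
    by (intro N.integrable_const_bound[of _ "\<bar>a\<bar> + \<bar>D\<bar>"]) (auto intro!: AE_I2 simp: abs_le_iff sp dest!: bnd)
  have key: "(\<integral>x. g x \<partial>M) - (\<integral>x. g x \<partial>N) \<le> d * D + D / real n" if n: "0 < n" for n
  proof -
    \<comment> \<open>\<open>B k\<close> is the set where \<open>g\<close> reaches the grid value
      \<open>a + k * D / n\<close>, so \<open>s\<close> is \<open>g\<close> rounded down to the
      grid.\<close>
    define B where "B k = {x \<in> space M. real k \<le> real n / D * (g x - a)}" for k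
    have [measurable]: "B k \<in> sets M" for k unfolding B_def by measurable
    have [measurable]: "B k \<in> sets N" for k using sets_eq by simp
    define s where "s x = a + D / n * (\<Sum>k=1..n. indicator (B k) x)" for x
    have s: "s x \<le> g x \<and> g x \<le> s x + D / n" if "x \<in> space M" for x
    proof -
      let ?z = "real n / D * (g x - a)"
      have z: "0 \<le> ?z" "?z \<le> real n" using bnd[OF that] D n mult_left_mono[of "g x" "a + D" "real n"]
        by (auto simp: field_simps)
      have "s x = a + D / n * (\<Sum>k=1..n. indicator {t. real k \<le> t} ?z)"
        unfolding s_def using that by (auto simp: B_def indicator_def intro!: sum.cong)
      then have sx: "s x = a + D / n * real_of_int \<lfloor>?z\<rfloor>" by (simp only: sum_indicator_eq_floor[OF z])
      have gx: "g x = a + D / n * ?z" using D n by simp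
      have "D / n * real_of_int \<lfloor>?z\<rfloor> \<le> D / n * ?z" "D / n * ?z \<le> D / n * (real_of_int \<lfloor>?z\<rfloor> + 1)"
        using D n by (intro mult_left_mono; simp)+
      then show ?thesis unfolding sx using gx by (simp add: distrib_left)
    qed
    define c where "c = D / n"
    have ind: "integrable M (indicator (B k) :: _ \<Rightarrow> real)" "integrable N (indicator (B k) :: _ \<Rightarrow> real)" for k
      by (auto intro!: integrable_real_indicator simp: M.emeasure_finite N.emeasure_finite less_top[symmetric])
    have isM: "integrable M s" and isN: "integrable N s"
      unfolding s_def c_def[symmetric] by (simp_all add: ind)
    have intM: "(\<integral>x. s x \<partial>M) = a + D / n * (\<Sum>k=1..n. measure M (B k))"
      unfolding s_def c_def[symmetric] by (simp add: ind M.prob_space)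
    have intN: "(\<integral>x. s x \<partial>N) = a + D / n * (\<Sum>k=1..n. measure N (B k))"
      unfolding s_def c_def[symmetric] by (simp add: ind N.prob_space)
    \<comment> \<open>The rounding error is paid for \<open>M\<close> only; under \<open>N\<close>
      the inequality \<open>s \<le> g\<close> already points the right way.\<close>
    have "(\<integral>x. g x \<partial>M) \<le> (\<integral>x. s x + D / n \<partial>M)" using s iM isM by (intro integral_mono) auto
    also have "\<dots> = a + D / n * (\<Sum>k=1..n. measure M (B k)) + D / n"
      using isM intM by (simp add: M.prob_space)
    finally have 1: "(\<integral>x. g x \<partial>M) \<le> a + D / n * (\<Sum>k=1..n. measure M (B k)) + D / n" .
    have "(\<integral>x. s x \<partial>N) \<le> (\<integral>x. g x \<partial>N)" using s iN isN sp by (intro integral_mono) auto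
    then have 2: "a + D / n * (\<Sum>k=1..n. measure N (B k)) \<le> (\<integral>x. g x \<partial>N)" unfolding intN .
    have "(\<Sum>k=1..n. measure M (B k)) - (\<Sum>k=1..n. measure N (B k)) \<le> (\<Sum>k=1..n. d)"
      unfolding sum_subtractf[symmetric] by (intro sum_mono tv) auto
    then have "D / n * ((\<Sum>k=1..n. measure M (B k)) - (\<Sum>k=1..n. measure N (B k))) \<le> D / n * (n * d)"
      using D by (intro mult_left_mono) auto
    also have "\<dots> = d * D" using n by simp
    finally show ?thesis using 1 2 by (simp add: right_diff_distrib)
  qed
  have "(\<lambda>n. d * D + D / real n) \<longlonglongrightarrow> d * D + 0"
    by (intro tendsto_add tendsto_const lim_const_over_n)
  then show ?thesis
    by (intro tendsto_lowerbound[where F=sequentially and f="\<lambda>n. d * D + D / real n"])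
       (auto intro!: eventually_sequentiallyI[of 1] key)
qed

text \<open>Total variation without the factor two, so that any two probability measures are within
  1. A relation instead of a supremum, because the bounds are used set by set.\<close>

definition tv_le :: "real \<Rightarrow> 'e::topological_space measure \<Rightarrow> 'e measure \<Rightarrow> bool" where
  "tv_le d M N \<longleftrightarrow> (\<forall>B\<in>sets borel. \<bar>measure M B - measure N B\<bar> \<le> d)"

lemma tv_leD: "tv_le d M N \<Longrightarrow> B \<in> sets borel \<Longrightarrow> \<bar>measure M B - measure N B\<bar> \<le> d"
  by (simp add: tv_le_def)

lemma tv_le_commute: "tv_le d M N \<longleftrightarrow> tv_le d N M"
  by (simp add: tv_le_def abs_minus_commute)

lemma tv_le_1:
  assumes "prob_space M" "prob_space N"
  shows "tv_le 1 M N"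
proof -
  interpret M: prob_space M by fact
  interpret N: prob_space N by fact
  show ?thesis
    unfolding tv_le_def
  proof
    fix B
    show "\<bar>measure M B - measure N B\<bar> \<le> 1"
      using M.prob_le_1[of B] N.prob_le_1[of B] measure_nonneg[of M B] measure_nonneg[of N B] by linarith
  qed
qed

lemma measure_bind_prob_algebra:
  assumes M: "M \<in> space (prob_algebra N)" and L: "L \<in> N \<rightarrow>\<^sub>M prob_algebra R" and B: "B \<in> sets R"
  shows "measure (M \<bind> L) B = (\<integral>x. measure (L x) B \<partial>M)"
proof -
  interpret M: prob_space M using M by (simp add: space_prob_algebra)
  have [measurable_cong]: "sets M = sets N" using M by (simp add: space_prob_algebra)
  have sp: "space M = space N" by (rule sets_eq_imp_space_eq) fact
  have pL: "prob_space (L x)" if "x \<in> space M" for x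
    using measurable_space[OF L] that sp by (auto simp: space_prob_algebra)
  note [measurable] = L B
  interpret bnd: prob_space "M \<bind> L" by (rule prob_space_bind'[OF M L])
  have "ennreal (measure (M \<bind> L) B) = (\<integral>\<^sup>+x. emeasure (L x) B \<partial>M)"
    unfolding bnd.emeasure_eq_measure[symmetric] by (rule emeasure_bind_prob_algebra[OF M L B])
  also have "\<dots> = (\<integral>\<^sup>+x. ennreal (measure (L x) B) \<partial>M)"
    by (intro nn_integral_cong finite_measure.emeasure_eq_measure)
       (auto intro: prob_space.finite_measure pL)
  also have "\<dots> = ennreal (\<integral>x. measure (L x) B \<partial>M)"
  proof (rule nn_integral_eq_integral)
    show "integrable M (\<lambda>x. measure (L x) B)"
      by (rule M.integrable_const_bound[of _ 1]) (auto intro!: AE_I2 prob_space.prob_le_1 pL)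
  qed auto
  finally show ?thesis by simp
qed

section \<open>Second-order bounds for exponential moments\<close>

lemma exp_le_1_add_square:
  fixes x :: real
  assumes "\<bar>x\<bar> \<le> 1"
  shows "exp x \<le> 1 + x + x\<^sup>2"
proof (cases "0 \<le> x")
  case True
  then show ?thesis using assms by (intro exp_bound) auto
next
  case False
  define y where "y = - x"
  have y: "0 \<le> y" using False by (simp add: y_def)
  have pos: "0 < 1 + y + y\<^sup>2 / 2" using y by (simp add: add_pos_nonneg)
  \<comment> \<open>For negative \<open>x = - y\<close>, \<open>exp x\<close> is the reciprocal of
    \<open>exp y\<close>, which is at least \<open>1 + y + y^2 / 2\<close>. The product computed
    here shows that \<open>1 - y + y^2\<close> dominates the reciprocal of that polynomial.\<close>
  have "1 \<le> 1 + y\<^sup>2 / 2 + y ^ 3 / 2 + y ^ 4 / 2" using y by simp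
  also have "\<dots> = (1 - y + y\<^sup>2) * (1 + y + y\<^sup>2 / 2)"
    by (simp add: field_simps power2_eq_square power3_eq_cube power4_eq_xxxx)
  finally have "1 / (1 + y + y\<^sup>2 / 2) \<le> 1 - y + y\<^sup>2" using pos by (simp add: divide_le_eq)
  moreover have "exp x \<le> 1 / (1 + y + y\<^sup>2 / 2)"
    using exp_lower_Taylor_quadratic[OF y] pos
    by (simp add: y_def exp_minus inverse_eq_divide divide_simps mult.commute)
  ultimately show ?thesis by (simp add: y_def)
qed

text \<open>The lower bound is Jensen's inequality. For the upper one, \<open>h\<close> is centred
  at its mean \<open>m\<close>: \<open>X\<close> has mean zero, so only the square in
  \<open>exp X \<le> 1 + X + X^2\<close> survives. As \<open>h\<close> differs from \<open>m\<close>
  by at most \<open>2 * c\<close>, the condition on \<alpha> puts \<open>X\<close> in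
  \<open>[-1, 1]\<close>, and \<open>X^2\<close> is at most
  \<open>4 * \<alpha>^2 * c^2\<close>.\<close>

lemma (in prob_space) exp_expectation_bounds:
  fixes h :: "'a \<Rightarrow> real"
  assumes h[measurable]: "h \<in> borel_measurable M" and c: "\<And>y. \<bar>h y\<bar> \<le> c" and \<alpha>: "2 * c * \<bar>\<alpha>\<bar> \<le> 1"
  shows "exp (\<alpha> * expectation h) \<le> expectation (\<lambda>y. exp (\<alpha> * h y))"
    and "expectation (\<lambda>y. exp (\<alpha> * h y)) \<le> exp (\<alpha> * expectation h + 4 * \<alpha>\<^sup>2 * c\<^sup>2)"
proof -
  define m where "m = expectation h"
  define X where "X y = \<alpha> * (h y - m)" for y
  have [measurable]: "X \<in> borel_measurable M" unfolding X_def by measurable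
  have ih: "integrable M h" by (rule integrable_const_bound[of _ c]) (auto simp: c)
  have "\<bar>m\<bar> \<le> expectation (\<lambda>y. \<bar>h y\<bar>)" unfolding m_def by (rule integral_abs_bound)
  also have "\<dots> \<le> expectation (\<lambda>_. c)" using ih c by (intro integral_mono) auto
  finally have m: "\<bar>m\<bar> \<le> c" by (simp add: prob_space)
  have hm: "\<bar>h y - m\<bar> \<le> 2 * c" for y using m c[of y] by linarith
  have X: "\<bar>X y\<bar> \<le> 1" for y
    using mult_left_mono[OF hm[of y], of "\<bar>\<alpha>\<bar>"] \<alpha> by (simp add: X_def abs_mult mult.commute)
  have X2: "(X y)\<^sup>2 \<le> 4 * \<alpha>\<^sup>2 * c\<^sup>2" for y
    using mult_left_mono[OF power_mono[OF hm[of y], of 2], of "\<alpha>\<^sup>2"]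
    by (simp add: X_def power_mult_distrib)
  have iX: "integrable M X" unfolding X_def using ih by simp
  have EX: "expectation X = 0" unfolding X_def using ih by (simp add: m_def prob_space)
  have iexp: "integrable M (\<lambda>y. exp (X y))"
  proof (rule integrable_const_bound[of _ "exp 1"])
    show "AE y in M. norm (exp (X y)) \<le> exp 1" using X by (auto simp: abs_le_iff)
  qed simp
  have eq: "expectation (\<lambda>y. exp (\<alpha> * h y)) = exp (\<alpha> * m) * expectation (\<lambda>y. exp (X y))"
    by (subst integral_mult_right_zero[symmetric])
       (auto intro!: Bochner_Integration.integral_cong simp: X_def exp_add[symmetric] algebra_simps)
  have "1 = expectation (\<lambda>y. 1 + X y)" using iX EX by (simp add: prob_space)
  also have "\<dots> \<le> expectation (\<lambda>y. exp (X y))"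
    using iX iexp by (intro integral_mono) (auto simp: exp_ge_add_one_self)
  finally show "exp (\<alpha> * expectation h) \<le> expectation (\<lambda>y. exp (\<alpha> * h y))"
    unfolding eq m_def[symmetric] by simp
  have "expectation (\<lambda>y. exp (X y)) \<le> expectation (\<lambda>y. 1 + X y + 4 * \<alpha>\<^sup>2 * c\<^sup>2)"
    using iX iexp order_trans[OF exp_le_1_add_square[OF X] add_left_mono[OF X2]]
    by (intro integral_mono) auto
  also have "\<dots> = 1 + 4 * \<alpha>\<^sup>2 * c\<^sup>2" using iX EX by (simp add: prob_space)
  also have "\<dots> \<le> exp (4 * \<alpha>\<^sup>2 * c\<^sup>2)" by (rule exp_ge_add_one_self)
  finally show "expectation (\<lambda>y. exp (\<alpha> * h y)) \<le> exp (\<alpha> * expectation h + 4 * \<alpha>\<^sup>2 * c\<^sup>2)"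
    unfolding eq m_def[symmetric] exp_add by simp
qed

section \<open>Exponential functionals along the path\<close>

context Ionescu_Tulcea
begin

text \<open>In general \<open>CI J\<close> is a marginal of a finite composition
  \<open>C 0 n\<close>. For a full initial segment there is nothing to integrate out: the cylinder
  over a set is the set itself.\<close>

lemma CI_atLeastLessThan: "CI {0..<n} = C 0 n (\<lambda>_. undefined)"
proof (rule measure_eqI)
  show s: "sets (CI {0..<n}) = sets (C 0 n (\<lambda>_. undefined))"
    by (simp add: CI_def sets_C)
  fix X assume "X \<in> sets (CI {0..<n})"
  then have X: "X \<in> sets (PiM {0..<n} M)" using s by (simp add: sets_C)
  show "emeasure (CI {0..<n}) X = emeasure (C 0 n (\<lambda>_. undefined)) X"
    using emeasure_CI[OF order_refl X] sets.sets_into_space[OF X]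
    by (simp add: prod_emb_id space_PiM)
qed

lemma nn_integral_lim_restrict:
  assumes [measurable]: "G \<in> borel_measurable (PiM {0..<n} M)"
  shows "(\<integral>\<^sup>+\<omega>. G (restrict \<omega> {0..<n}) \<partial>PF.lim) = (\<integral>\<^sup>+\<omega>. G \<omega> \<partial>C 0 n (\<lambda>_. undefined))"
  unfolding CI_atLeastLessThan[symmetric] distr_lim[OF finite_atLeastLessThan, symmetric]
  by (subst nn_integral_distr) (auto simp: measurable_cong_sets[OF PF.sets_lim])

text \<open>Conditioning on the first \<open>n\<close> coordinates: \<open>C 0 (Suc n)\<close> is
  \<open>C 0 n\<close> followed by \<open>eP n\<close>, which appends a coordinate drawn from
  \<open>P n\<close>. Both sides are read on the limit, so that an induction on \<open>n\<close>
  stays within one measure.\<close>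

lemma nn_integral_lim_Suc:
  assumes [measurable]: "G \<in> borel_measurable (PiM {0..<Suc n} M)"
  shows "(\<integral>\<^sup>+\<omega>. G (restrict \<omega> {0..<Suc n}) \<partial>PF.lim)
    = (\<integral>\<^sup>+\<omega>. (\<integral>\<^sup>+y. G ((restrict \<omega> {0..<n})(n := y)) \<partial>P n (restrict \<omega> {0..<n})) \<partial>PF.lim)"
proof -
  let ?u = "\<lambda>_. undefined :: 'a"
  have u: "?u \<in> space (PiM {0..<0} M)" by simp
  have "(\<integral>\<^sup>+\<omega>. G (restrict \<omega> {0..<Suc n}) \<partial>PF.lim) = (\<integral>\<^sup>+\<omega>. G \<omega> \<partial>C 0 (Suc n) ?u)"
    by (rule nn_integral_lim_restrict) measurable
  also have "\<dots> = (\<integral>\<^sup>+\<omega>. (\<integral>\<^sup>+z. G z \<partial>eP n \<omega>) \<partial>C 0 n ?u)"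
    using measurable_eP[of n]
    by (simp, subst nn_integral_bind[where B="PiM {0..<Suc n} M"])
       (auto simp: sets_C[OF u] cong: measurable_cong_sets)
  also have "\<dots> = (\<integral>\<^sup>+\<omega>. (\<integral>\<^sup>+z. G z \<partial>eP n (restrict \<omega> {0..<n})) \<partial>PF.lim)"
    by (rule nn_integral_lim_restrict[symmetric]) measurable
  also have "\<dots> = (\<integral>\<^sup>+\<omega>. (\<integral>\<^sup>+y. G ((restrict \<omega> {0..<n})(n := y)) \<partial>P n (restrict \<omega> {0..<n})) \<partial>PF.lim)"
    by (intro nn_integral_cong nn_integral_eP) (auto simp: space_PiM)
  finally show ?thesis .
qed

lemma prob_space_lim: "prob_space PF.lim"
proof (rule prob_spaceI)
  have "(\<integral>\<^sup>+\<omega>. 1 \<partial>PF.lim) = (\<integral>\<^sup>+\<omega>. 1 \<partial>C 0 0 (\<lambda>_. undefined))"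
    by (rule nn_integral_lim_restrict) simp
  then show "emeasure PF.lim (space PF.lim) = 1"
    using prob_space.emeasure_space_1[OF prob_space_C[of "\<lambda>_. undefined" 0 0]] by simp
qed

end

section \<open>Exponential functionals of a Markov chain\<close>

locale markov =
  fixes K :: "'e::topological_space \<Rightarrow> 'e measure"
  assumes kernel: "markov_kernel K"
begin

lemma sets_path_measure[measurable_cong]: "sets (path_measure K x) = sets (PiM UNIV (\<lambda>_. borel))"
proof -
  interpret Ionescu_Tulcea "path_step K x" "\<lambda>_. borel" by (rule Ionescu_Tulcea_path_step[OF kernel])
  show ?thesis unfolding path_measure_def by simp
qed

text \<open>The Markov property in integrated form. The horizon is \<open>Suc (Suc n)\<close>
  because \<open>K\<close> governs the coordinates \<open>Suc n\<close>, reading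
  \<open>\<omega> n\<close>; coordinate 0 is deterministic and is treated on its own.\<close>

lemma nn_integral_path_Suc:
  assumes "G \<in> borel_measurable (PiM {0..<Suc (Suc n)} (\<lambda>_. borel))"
  shows "(\<integral>\<^sup>+\<omega>. G (restrict \<omega> {0..<Suc (Suc n)}) \<partial>path_measure K x)
    = (\<integral>\<^sup>+\<omega>. (\<integral>\<^sup>+y. G ((restrict \<omega> {0..<Suc n})(Suc n := y)) \<partial>K (\<omega> n)) \<partial>path_measure K x)"
proof -
  interpret Ionescu_Tulcea "path_step K x" "\<lambda>_. borel" by (rule Ionescu_Tulcea_path_step[OF kernel])
  show ?thesis
    using nn_integral_lim_Suc[OF assms] unfolding path_measure_def by (simp add: path_step_def)
qed

lemma nn_integral_path_0:
  assumes [measurable]: "g \<in> borel_measurable borel"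
  shows "(\<integral>\<^sup>+\<omega>. g (\<omega> 0) \<partial>path_measure K x) = g x"
proof -
  interpret Ionescu_Tulcea "path_step K x" "\<lambda>_. borel" by (rule Ionescu_Tulcea_path_step[OF kernel])
  interpret L: prob_space PF.lim by (rule prob_space_lim)
  have "(\<lambda>\<omega>. g (\<omega> 0)) \<in> borel_measurable (PiM {0..<Suc 0} (\<lambda>_. borel))" by measurable
  from nn_integral_lim_Suc[OF this]
  show ?thesis
    unfolding path_measure_def by (simp add: path_step_def nn_integral_return L.emeasure_space_1[simplified])
qed

text \<open>Under these bounds \<open>exp (\<Sum>i<n. f (X i) + g (X n))\<close> is a martingale up to a factor between
  \<open>exp a\<close> and \<open>exp b\<close> per step.\<close>

lemma nn_integral_path_exp_bounds:
  fixes f g :: "'e \<Rightarrow> real"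
  assumes [measurable]: "f \<in> borel_measurable borel" "g \<in> borel_measurable borel"
    and low: "\<And>y. ennreal (exp (a + g y)) \<le> ennreal (exp (f y)) * (\<integral>\<^sup>+z. ennreal (exp (g z)) \<partial>K y)"
    and upp: "\<And>y. ennreal (exp (f y)) * (\<integral>\<^sup>+z. ennreal (exp (g z)) \<partial>K y) \<le> ennreal (exp (b + g y))"
  shows "ennreal (exp (real n * a + g x)) \<le> (\<integral>\<^sup>+\<omega>. ennreal (exp ((\<Sum>i<n. f (\<omega> i)) + g (\<omega> n))) \<partial>path_measure K x)
    \<and> (\<integral>\<^sup>+\<omega>. ennreal (exp ((\<Sum>i<n. f (\<omega> i)) + g (\<omega> n))) \<partial>path_measure K x) \<le> ennreal (exp (real n * b + g x))"
proof (induction n)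
  case 0
  show ?case using nn_integral_path_0[of "\<lambda>y. ennreal (exp (g y))" x] by simp
next
  case (Suc n)
  let ?L = "path_measure K x"
  let ?S = "\<lambda>\<omega>. \<Sum>i<n. f (\<omega> i)"
  let ?Z = "\<lambda>\<omega>. ennreal (exp (?S \<omega> + g (\<omega> n)))"
  let ?Z' = "\<lambda>\<omega>. ennreal (exp ((\<Sum>i<Suc n. f (\<omega> i)) + g (\<omega> (Suc n))))"
  have K_sets: "sets (K y) = sets borel" for y
    using measurable_space[OF kernel[unfolded markov_kernel_def], of y] by (simp add: space_prob_algebra)
  have m: "?Z' \<in> borel_measurable (PiM {0..<Suc (Suc n)} (\<lambda>_. borel))" by measurable
  \<comment> \<open>The functional reads only coordinates up to \<open>Suc n\<close>, so restricting
    the path does not change it.\<close>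
  have r: "?Z' (restrict \<omega> {0..<Suc (Suc n)}) = ?Z' \<omega>" for \<omega>
    by (intro arg_cong[where f=ennreal] arg_cong[where f=exp] arg_cong2[where f="(+)"] sum.cong) auto
  have upd: "?Z' ((restrict \<omega> {0..<Suc n})(Suc n := y)) = ennreal (exp (?S \<omega> + f (\<omega> n) + g y))" for \<omega> y
  proof -
    have "(\<Sum>i<Suc n. f (((restrict \<omega> {0..<Suc n})(Suc n := y)) i)) = (\<Sum>i<Suc n. f (\<omega> i))"
      by (intro sum.cong) auto
    then show ?thesis by simp
  qed
  \<comment> \<open>The past is constant for the integral over the new coordinate. What remains is
    the expression bounded by \<open>low\<close> and \<open>upp\<close> at
    \<open>y = \<omega> n\<close>.\<close>
  have inner: "(\<integral>\<^sup>+y. ennreal (exp (?S \<omega> + f (\<omega> n) + g y)) \<partial>K (\<omega> n))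
      = ennreal (exp (?S \<omega>)) * (ennreal (exp (f (\<omega> n))) * (\<integral>\<^sup>+y. ennreal (exp (g y)) \<partial>K (\<omega> n)))" for \<omega>
  proof -
    have "(\<lambda>y. ennreal (exp (g y))) \<in> borel_measurable (K (\<omega> n))"
      unfolding measurable_cong_sets[OF K_sets refl] by measurable
    from nn_integral_cmult[OF this, of "ennreal (exp (?S \<omega> + f (\<omega> n)))"] show ?thesis
      by (simp add: exp_add ennreal_mult' mult.assoc)
  qed
  have eq: "(\<integral>\<^sup>+\<omega>. ?Z' \<omega> \<partial>?L)
      = (\<integral>\<^sup>+\<omega>. ennreal (exp (?S \<omega>)) * (ennreal (exp (f (\<omega> n))) * (\<integral>\<^sup>+y. ennreal (exp (g y)) \<partial>K (\<omega> n))) \<partial>?L)"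
    using nn_integral_path_Suc[OF m, of x] unfolding r upd inner .
  have shift: "(\<integral>\<^sup>+\<omega>. ennreal (exp (?S \<omega>)) * ennreal (exp (d + g (\<omega> n))) \<partial>?L) = ennreal (exp d) * (\<integral>\<^sup>+\<omega>. ?Z \<omega> \<partial>?L)" for d
  proof -
    have "?Z \<in> borel_measurable ?L" by measurable
    from nn_integral_cmult[OF this, of "ennreal (exp d)", symmetric] show ?thesis
      by (simp add: ennreal_mult'[symmetric] exp_add[symmetric] add.left_commute)
  qed
  have "ennreal (exp a) * (\<integral>\<^sup>+\<omega>. ?Z \<omega> \<partial>?L) \<le> (\<integral>\<^sup>+\<omega>. ?Z' \<omega> \<partial>?L)"
    unfolding eq shift[symmetric] by (intro nn_integral_mono mult_left_mono low) auto
  moreover have "(\<integral>\<^sup>+\<omega>. ?Z' \<omega> \<partial>?L) \<le> ennreal (exp b) * (\<integral>\<^sup>+\<omega>. ?Z \<omega> \<partial>?L)"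
    unfolding eq shift[symmetric] by (intro nn_integral_mono mult_left_mono upp) auto
  moreover have "ennreal (exp (real (Suc n) * d + g x)) = ennreal (exp d) * ennreal (exp (real n * d + g x))" for d
    by (simp add: ennreal_mult'[symmetric] exp_add[symmetric] algebra_simps)
  moreover note Suc.IH
  ultimately show ?case
    by (auto intro: order_trans[OF mult_left_mono] order_trans[OF _ mult_left_mono])
qed

text \<open>The martingale bounds are applied with \<open>f = \<alpha> * (indicator B - p)\<close>
  and \<open>g = \<alpha> * h\<close>. The error per step is the defect \<delta> of the Poisson
  equation, scaled by \<open>\<bar>\<alpha>\<bar>\<close>, plus the second-order term of the
  exponential moment. The boundary terms, \<open>g\<close> at the initial and at the final state,
  cost \<open>\<bar>\<alpha>\<bar> * c\<close> each.\<close>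

lemma ln_path_integral_bound:
  fixes h :: "'e \<Rightarrow> real"
  assumes B[measurable]: "B \<in> sets borel" and h[measurable]: "h \<in> borel_measurable borel"
    and c: "\<And>y. \<bar>h y\<bar> \<le> c" and \<alpha>: "2 * c * \<bar>\<alpha>\<bar> \<le> 1"
    and poisson: "\<And>y. \<bar>indicator B y - p - (h y - (\<integral>z. h z \<partial>K y))\<bar> \<le> \<delta>"
  shows "\<bar>ln (\<integral>\<omega>. exp (\<alpha> * (\<Sum>i<n. indicator B (\<omega> i))) \<partial>path_measure K x) - \<alpha> * (real n * p)\<bar>
    \<le> real n * (\<bar>\<alpha>\<bar> * \<delta> + 4 * \<alpha>\<^sup>2 * c\<^sup>2) + 2 * \<bar>\<alpha>\<bar> * c"
proof -
  let ?L = "path_measure K x"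
  define e where "e = \<bar>\<alpha>\<bar> * \<delta> + 4 * \<alpha>\<^sup>2 * c\<^sup>2"
  define f where "f y = \<alpha> * (indicator B y - p)" for y
  define g where "g y = \<alpha> * h y" for y
  have [measurable]: "f \<in> borel_measurable borel" "g \<in> borel_measurable borel"
    unfolding f_def g_def by measurable
  have g: "\<bar>g y\<bar> \<le> \<bar>\<alpha>\<bar> * c" for y
    unfolding g_def abs_mult by (intro mult_left_mono c) simp
  have step: "ennreal (exp (- e + g y)) \<le> ennreal (exp (f y)) * (\<integral>\<^sup>+z. ennreal (exp (g z)) \<partial>K y) \<and>
    ennreal (exp (f y)) * (\<integral>\<^sup>+z. ennreal (exp (g z)) \<partial>K y) \<le> ennreal (exp (e + g y))" for y
  proof -
    have Ky: "K y \<in> space (prob_algebra borel)"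
      using measurable_space[OF kernel[unfolded markov_kernel_def], of y] by simp
    then interpret K: prob_space "K y" by (simp add: space_prob_algebra)
    have [measurable_cong]: "sets (K y) = sets borel" using Ky by (simp add: space_prob_algebra)
    have hK: "h \<in> borel_measurable (K y)" by measurable
    note bnds = K.exp_expectation_bounds[OF hK c \<alpha>]
    let ?I = "\<integral>z. exp (g z) \<partial>K y"
    have "integrable (K y) (\<lambda>z. exp (g z))"
      using g by (intro K.integrable_const_bound[of _ "exp (\<bar>\<alpha>\<bar> * c)"]) (auto simp: abs_le_iff)
    then have nn: "(\<integral>\<^sup>+z. ennreal (exp (g z)) \<partial>K y) = ennreal ?I"
      by (intro nn_integral_eq_integral) auto
    \<comment> \<open>\<open>r\<close> is the defect of the Poisson equation at \<open>y\<close>; by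
      \<open>eq\<close> below, \<open>f y\<close> plus the mean of \<open>g\<close> after one step
      is \<open>g y\<close> up to \<open>\<alpha> * r\<close>.\<close>
    define r where "r = indicator B y - p - (h y - (\<integral>z. h z \<partial>K y))"
    have "\<bar>\<alpha> * r\<bar> \<le> \<bar>\<alpha>\<bar> * \<delta>"
      unfolding abs_mult r_def by (intro mult_left_mono poisson) simp
    then have r: "- (\<bar>\<alpha>\<bar> * \<delta>) \<le> \<alpha> * r" "\<alpha> * r \<le> \<bar>\<alpha>\<bar> * \<delta>"
      by (simp_all add: abs_le_iff)
    have sq: "0 \<le> 4 * \<alpha>\<^sup>2 * c\<^sup>2" by simp
    have eq: "f y + \<alpha> * (\<integral>z. h z \<partial>K y) = g y + \<alpha> * r"
      unfolding f_def g_def r_def by (simp add: algebra_simps)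
    have "exp (- e + g y) \<le> exp (f y + \<alpha> * (\<integral>z. h z \<partial>K y))"
      unfolding eq e_def exp_le_cancel_iff using r(1) sq by linarith
    also have "\<dots> \<le> exp (f y) * ?I" unfolding exp_add g_def using bnds(1) by simp
    finally have 1: "exp (- e + g y) \<le> exp (f y) * ?I" .
    have "exp (f y) * ?I \<le> exp (f y) * exp (\<alpha> * (\<integral>z. h z \<partial>K y) + 4 * \<alpha>\<^sup>2 * c\<^sup>2)"
      unfolding g_def using bnds(2) by simp
    also have "\<dots> = exp (f y + \<alpha> * (\<integral>z. h z \<partial>K y) + 4 * \<alpha>\<^sup>2 * c\<^sup>2)" by (simp add: exp_add)
    also have "\<dots> \<le> exp (e + g y)" unfolding eq e_def exp_le_cancel_iff using r(2) by linarith
    finally show ?thesis using 1 unfolding nn by (simp add: ennreal_mult'[symmetric])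
  qed
  note Z = nn_integral_path_exp_bounds[of f g "- e" e n x, OF _ _ step[THEN conjunct1] step[THEN conjunct2]]
  let ?Z = "\<integral>\<^sup>+\<omega>. ennreal (exp ((\<Sum>i<n. f (\<omega> i)) + g (\<omega> n))) \<partial>?L"
  let ?A = "\<lambda>\<omega>. \<alpha> * (\<Sum>i<n. indicator B (\<omega> i))"
  let ?N = "\<integral>\<^sup>+\<omega>. ennreal (exp (?A \<omega>)) \<partial>?L"
  \<comment> \<open>Undoing the centring by \<open>p\<close> only adds a deterministic term.\<close>
  have A: "?A \<omega> = \<alpha> * (real n * p) + (\<Sum>i<n. f (\<omega> i))" for \<omega>
    by (simp add: f_def sum_distrib_left[symmetric] sum_subtractf algebra_simps)
  have gn: "- (\<bar>\<alpha>\<bar> * c) \<le> g y" "g y \<le> \<bar>\<alpha>\<bar> * c" for y using g[of y] by (auto simp: abs_le_iff)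
  \<comment> \<open>The final term \<open>g (\<omega> n)\<close> is absent from the occupation
    functional and is traded for its bound.\<close>
  have U: "exp (?A \<omega>) \<le> exp (\<alpha> * (real n * p) + \<bar>\<alpha>\<bar> * c) * exp ((\<Sum>i<n. f (\<omega> i)) + g (\<omega> n))"
    and L: "exp (\<alpha> * (real n * p) - \<bar>\<alpha>\<bar> * c) * exp ((\<Sum>i<n. f (\<omega> i)) + g (\<omega> n)) \<le> exp (?A \<omega>)" for \<omega>
    unfolding A exp_add[symmetric] exp_le_cancel_iff using gn[of "\<omega> n"] by linarith+
  have Z1: "ennreal (exp (- real n * e - \<bar>\<alpha>\<bar> * c)) \<le> ?Z"
    by (rule order_trans[OF _ Z[THEN conjunct1]]) (use gn(1)[of x] in simp_all)
  have Z2: "?Z \<le> ennreal (exp (real n * e + \<bar>\<alpha>\<bar> * c))"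
    by (rule order_trans[OF Z[THEN conjunct2]]) (use gn(2)[of x] in simp_all)
  have "?N \<le> (\<integral>\<^sup>+\<omega>. ennreal (exp (\<alpha> * (real n * p) + \<bar>\<alpha>\<bar> * c)) * ennreal (exp ((\<Sum>i<n. f (\<omega> i)) + g (\<omega> n))) \<partial>?L)"
    by (intro nn_integral_mono) (simp add: ennreal_mult'[symmetric] U del: exp_le_cancel_iff)
  also have "\<dots> = ennreal (exp (\<alpha> * (real n * p) + \<bar>\<alpha>\<bar> * c)) * ?Z" by (rule nn_integral_cmult) measurable
  also have "\<dots> \<le> ennreal (exp (\<alpha> * (real n * p) + \<bar>\<alpha>\<bar> * c)) * ennreal (exp (real n * e + \<bar>\<alpha>\<bar> * c))"
    by (intro mult_left_mono Z2) simp
  finally have upper: "?N \<le> ennreal (exp (\<alpha> * (real n * p) + real n * e + 2 * \<bar>\<alpha>\<bar> * c))"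
    by (simp add: ennreal_mult'[symmetric] exp_add[symmetric] algebra_simps)
  have "ennreal (exp (\<alpha> * (real n * p) - \<bar>\<alpha>\<bar> * c)) * ennreal (exp (- real n * e - \<bar>\<alpha>\<bar> * c))
      \<le> ennreal (exp (\<alpha> * (real n * p) - \<bar>\<alpha>\<bar> * c)) * ?Z"
    by (intro mult_left_mono Z1) simp
  also have "\<dots> = (\<integral>\<^sup>+\<omega>. ennreal (exp (\<alpha> * (real n * p) - \<bar>\<alpha>\<bar> * c)) * ennreal (exp ((\<Sum>i<n. f (\<omega> i)) + g (\<omega> n))) \<partial>?L)"
    by (rule nn_integral_cmult[symmetric]) measurable
  also have "\<dots> \<le> ?N"
    by (intro nn_integral_mono) (simp add: ennreal_mult'[symmetric] L del: exp_le_cancel_iff)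
  finally have lower: "ennreal (exp (\<alpha> * (real n * p) - real n * e - 2 * \<bar>\<alpha>\<bar> * c)) \<le> ?N"
    by (simp add: ennreal_mult'[symmetric] exp_add[symmetric] algebra_simps)
  define J where "J = (\<integral>\<omega>. exp (?A \<omega>) \<partial>?L)"
  have "J = enn2real ?N"
    unfolding J_def by (rule integral_eq_nn_integral) auto
  \<comment> \<open>Finiteness matters: at infinity \<open>enn2real\<close> would return the default
    value 0.\<close>
  moreover have "?N < \<infinity>" using upper by (rule order.strict_trans1) simp
  ultimately have N: "?N = ennreal J" by simp
  have J: "exp (\<alpha> * (real n * p) - real n * e - 2 * \<bar>\<alpha>\<bar> * c) \<le> J"
    "J \<le> exp (\<alpha> * (real n * p) + real n * e + 2 * \<bar>\<alpha>\<bar> * c)"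
    using lower upper unfolding N by (simp_all add: ennreal_le_iff2 not_le[symmetric])
  have "0 < J" using J(1) by (rule order.strict_trans2[rotated]) simp
  then have "\<alpha> * (real n * p) - real n * e - 2 * \<bar>\<alpha>\<bar> * c \<le> ln J" "ln J \<le> \<alpha> * (real n * p) + real n * e + 2 * \<bar>\<alpha>\<bar> * c"
    using J(1) iffD2[OF ln_le_cancel_iff J(2)] by (simp_all add: ln_ge_iff)
  then show ?thesis unfolding J_def e_def[symmetric] by (auto simp: abs_le_iff)
qed

text \<open>Division by \<open>\<bar>\<alpha>\<bar> * n\<close> makes the boundary terms
  \<open>2 * c / n\<close>, which vanish in the limit, and turns the error per step into
  \<open>\<delta> + 4 * \<bar>\<alpha>\<bar> * c^2\<close>.\<close>

lemma occupation_growth_bound: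
  fixes h :: "'e \<Rightarrow> real"
  assumes B: "B \<in> sets borel" and h: "h \<in> borel_measurable borel"
    and c: "\<And>y. \<bar>h y\<bar> \<le> c" and \<alpha>: "2 * c * \<bar>\<alpha>\<bar> \<le> 1" "\<alpha> \<noteq> 0"
    and poisson: "\<And>y. \<bar>indicator B y - p - (h y - (\<integral>z. h z \<partial>K y))\<bar> \<le> \<delta>"
  shows "\<bar>occupation_growth K \<alpha> x B - ereal p\<bar> \<le> ereal (\<delta> + 4 * \<bar>\<alpha>\<bar> * c\<^sup>2)"
proof -
  define e where "e = \<delta> + 4 * \<bar>\<alpha>\<bar> * c\<^sup>2"
  define a where "a n = 1 / (\<alpha> * real n) *
       ln (\<integral>\<omega>. exp (\<alpha> * (\<Sum>i<n. indicator B (\<omega> i))) \<partial>path_measure K x)" for n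
  have a: "\<bar>a n - p\<bar> \<le> e + 2 * c / real n" if n: "0 < n" for n
  proof -
    have sq: "\<alpha>\<^sup>2 = \<bar>\<alpha>\<bar> * \<bar>\<alpha>\<bar>" by (simp add: power2_eq_square)
    have "\<bar>\<alpha> * n\<bar> * \<bar>a n - p\<bar> = \<bar>\<alpha> * n * a n - \<alpha> * (real n * p)\<bar>"
      unfolding abs_mult[symmetric] by (rule arg_cong[where f=abs]) (simp add: right_diff_distrib)
    also have "\<dots> \<le> real n * (\<bar>\<alpha>\<bar> * \<delta> + 4 * \<alpha>\<^sup>2 * c\<^sup>2) + 2 * \<bar>\<alpha>\<bar> * c"
      using ln_path_integral_bound[OF B h c \<alpha>(1) poisson, where n=n and x=x] n \<alpha>(2) by (simp add: a_def)
    also have "\<dots> = \<bar>\<alpha> * n\<bar> * (e + 2 * c / real n)"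
      using n unfolding e_def abs_mult sq by (simp add: field_simps)
    finally show ?thesis using n \<alpha>(2) by (simp add: abs_mult)
  qed
  have a_bounds: "p + (-1) * (e + 2 * c / real n) \<le> a n" "a n \<le> p + 1 * (e + 2 * c / real n)" if "1 \<le> n" for n
  proof -
    have *: "p + (-1) * t \<le> a n \<and> a n \<le> p + 1 * t" if "\<bar>a n - p\<bar> \<le> t" for t
      using that by auto
    have "0 < n" using that by simp
    from *[OF a[OF this]] show "p + (-1) * (e + 2 * c / real n) \<le> a n" "a n \<le> p + 1 * (e + 2 * c / real n)"
      by blast+
  qed
  \<comment> \<open>The signs \<open>s = -1\<close> and \<open>s = 1\<close> give the lower and the
    upper envelope, so one limit serves both.\<close>
  have lim: "(\<lambda>n. p + s * (e + 2 * c / real n)) \<longlonglongrightarrow> p + s * (e + 0)" for s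
    by (intro tendsto_intros lim_const_over_n)
  have lim: "liminf (\<lambda>n. ereal (p + s * (e + 2 * c / real n))) = ereal (p + s * (e + 0))" for s
    by (intro lim_imp_Liminf lim[THEN tendsto_ereal]) simp
  have occ: "occupation_growth K \<alpha> x B = liminf (\<lambda>n. ereal (a n))"
    unfolding occupation_growth_def a_def ..
  have "ereal (p + (-1) * (e + 0)) \<le> occupation_growth K \<alpha> x B"
    unfolding lim[symmetric] occ
    by (intro Liminf_mono eventually_sequentiallyI[of 1]) (simp only: ereal_less_eq a_bounds)
  moreover have "occupation_growth K \<alpha> x B \<le> ereal (p + 1 * (e + 0))"
    unfolding lim[symmetric] occ
    by (intro Liminf_mono eventually_sequentiallyI[of 1]) (simp only: ereal_less_eq a_bounds)
  ultimately have "ereal (p - e) \<le> occupation_growth K \<alpha> x B" "occupation_growth K \<alpha> x B \<le> ereal (p + e)"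
    by simp_all
  then show ?thesis
    unfolding e_def[symmetric] by (cases "occupation_growth K \<alpha> x B") (auto simp: abs_le_iff)
qed

end

section \<open>Geometric ergodicity\<close>

text \<open>(UE) for a single kernel. Exchanging \<open>x\<close> and \<open>y\<close> shows that
  any two of the laws \<open>K x\<close> are within \<Delta> in total variation.\<close>

locale doeblin = markov K for K :: "'e::topological_space \<Rightarrow> 'e measure" +
  fixes \<Delta> :: real
  assumes less_1: "\<Delta> < 1"
    and kernel_diff_le: "\<And>x y B. B \<in> sets borel \<Longrightarrow> measure (K x) B - measure (K y) B \<le> \<Delta>"
begin

lemma nonneg: "0 \<le> \<Delta>"
  using kernel_diff_le[of "{}"] by simp

lemma K_measurable[measurable]: "K \<in> borel \<rightarrow>\<^sub>M prob_algebra borel"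
  using kernel by (simp add: markov_kernel_def)

lemma power_measurable[measurable]: "kernel_power K n \<in> borel \<rightarrow>\<^sub>M prob_algebra borel"
  by (rule kernel_power_prob_algebra[OF kernel])

lemma K_in: "K y \<in> space (prob_algebra borel)"
  by (rule measurable_space[OF K_measurable]) simp

lemma power_in: "kernel_power K n y \<in> space (prob_algebra borel)"
  by (rule measurable_space[OF power_measurable]) simp

lemma bind_power_in: "M \<in> space (prob_algebra borel) \<Longrightarrow> M \<bind> kernel_power K n \<in> space (prob_algebra borel)"
  by (simp add: space_prob_algebra prob_space_bind'[OF _ power_measurable] sets_bind'[OF _ power_measurable])

lemma bind_assoc_K:
  assumes M: "M \<in> space (prob_algebra borel)"
    and L: "L \<in> borel \<rightarrow>\<^sub>M prob_algebra borel" and L': "L' \<in> borel \<rightarrow>\<^sub>M prob_algebra borel"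
  shows "(M \<bind> L) \<bind> L' = M \<bind> (\<lambda>y. L y \<bind> L')"
proof (rule bind_assoc)
  have "sets M = sets borel" using M by (simp add: space_prob_algebra)
  then show "L \<in> M \<rightarrow>\<^sub>M subprob_algebra borel"
    using measurable_prob_algebraD[OF L] by (simp cong: measurable_cong_sets)
qed (rule measurable_prob_algebraD[OF L'])

lemma bind_power_Suc:
  "M \<in> space (prob_algebra borel) \<Longrightarrow> M \<bind> kernel_power K (Suc n) = (M \<bind> kernel_power K n) \<bind> K"
  using bind_assoc_K[of M "kernel_power K n" K] by simp

text \<open>The recursion of \<open>kernel_power\<close> appends \<open>K\<close> at the end; here
  \<open>j\<close> steps are run first, so that in particular the first step can be split
  off.\<close>

lemma power_add: "kernel_power K (n + j) y = kernel_power K j y \<bind> kernel_power K n"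
proof (induction n)
  case 0
  have "sets (kernel_power K j y) = sets borel" using power_in by (simp add: space_prob_algebra)
  then show ?case by (simp add: bind_return'' del: kernel_power.simps(2))
next
  case (Suc n)
  show ?case unfolding bind_power_Suc[OF power_in] using Suc by simp
qed

lemma power_1: "kernel_power K 1 y = K y"
  using bind_return[OF measurable_prob_algebraD[OF K_measurable], of y] by simp

lemma measure_power_Suc:
  assumes "B \<in> sets borel"
  shows "measure (kernel_power K (Suc n) y) B = (\<integral>z. measure (kernel_power K n z) B \<partial>K y)"
  using power_add[of n 1 y] measure_bind_prob_algebra[OF K_in power_measurable assms]
  unfolding power_1 by simp

text \<open>By (UE) the function \<open>y \<mapsto> measure (K y) B\<close> has oscillation at most
  \<Delta>, so its integrals against two laws within \<open>d\<close> differ by at most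
  \<open>\<Delta> * d\<close>.\<close>

lemma bind_contract:
  assumes M: "M \<in> space (prob_algebra borel)" and N: "N \<in> space (prob_algebra borel)"
    and tv: "tv_le d M N"
  shows "tv_le (\<Delta> * d) (M \<bind> K) (N \<bind> K)"
proof -
  have *: "measure (M \<bind> K) B - measure (N \<bind> K) B \<le> \<Delta> * d"
    if M: "M \<in> space (prob_algebra borel)" and N: "N \<in> space (prob_algebra borel)"
      and tv: "tv_le d M N" and B: "B \<in> sets borel" for M N B
  proof -
    define a where "a = (INF y. measure (K y) B)"
    have bdd: "bdd_below (range (\<lambda>y. measure (K y) B))" by (rule bdd_belowI[of _ 0]) auto
    have le: "a \<le> measure (K y) B" for y unfolding a_def by (rule cINF_lower[OF bdd]) simp
    have "measure (K y) B - \<Delta> \<le> a" for y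
      unfolding a_def using kernel_diff_le[OF B, of y] by (intro cINF_greatest) (auto simp: algebra_simps)
    then have ge: "measure (K y) B \<le> a + \<Delta>" for y by (simp add: algebra_simps)
    have "sets M = sets borel" "sets N = sets borel" using M N by (simp_all add: space_prob_algebra)
    have "(\<integral>y. measure (K y) B \<partial>M) - (\<integral>y. measure (K y) B \<partial>N) \<le> d * \<Delta>"
    proof (rule integral_diff_le_of_measure_diff_le)
      show "prob_space M" "prob_space N" "sets N = sets M"
        using M N by (simp_all add: space_prob_algebra)
      show "measure M A - measure N A \<le> d" if "A \<in> sets M" for A
        using tv_leD[OF tv, of A] that \<open>sets M = _\<close> by simp
      show "(\<lambda>y. measure (K y) B) \<in> borel_measurable M"
        using B \<open>sets M = sets borel\<close> by (simp cong: measurable_cong_sets)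
    qed (use le ge nonneg in auto)
    then show ?thesis
      using measure_bind_prob_algebra[OF M K_measurable B] measure_bind_prob_algebra[OF N K_measurable B]
      by (simp add: mult.commute)
  qed
  show ?thesis
    using *[OF M N tv] *[OF N M tv[THEN tv_le_commute[THEN iffD1]]] unfolding tv_le_def by (auto simp: abs_le_iff)
qed

lemma bind_power_contract:
  assumes M: "M \<in> space (prob_algebra borel)" and N: "N \<in> space (prob_algebra borel)"
  shows "tv_le (\<Delta> ^ n) (M \<bind> kernel_power K n) (N \<bind> kernel_power K n)"
proof (induction n)
  case 0
  have "sets M = sets borel" "sets N = sets borel" using M N by (simp_all add: space_prob_algebra)
  then show ?case using M N by (simp add: bind_return'' tv_le_1 space_prob_algebra)
next
  case (Suc n)
  show ?case
    unfolding bind_power_Suc[OF M] bind_power_Suc[OF N] power_Suc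
    by (intro bind_contract bind_power_in M N Suc)
qed

lemma return_bind_power: "return borel y \<bind> kernel_power K n = kernel_power K n y"
  by (rule bind_return[OF measurable_prob_algebraD[OF power_measurable]]) simp

lemma return_in: "return borel y \<in> space (prob_algebra borel)"
  by (simp add: space_prob_algebra prob_space_return)

text \<open>Run \<open>n\<close> common steps from two initial laws, that of the chain after
  \<open>j\<close> steps from \<open>y\<close> and the point mass at \<open>z\<close>.\<close>

lemma power_cauchy: "tv_le (\<Delta> ^ n) (kernel_power K (n + j) y) (kernel_power K n z)"
  using bind_power_contract[OF power_in return_in, of n j y z]
  by (simp add: power_add return_bind_power del: kernel_power.simps)

section \<open>Existence and uniqueness of the invariant probability measure\<close>

lemma invariant_bind_power:
  assumes "invariant_prob K \<mu>"
  shows "\<mu> \<bind> kernel_power K n = \<mu>"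
proof (induction n)
  case 0
  then show ?case using assms by (simp add: invariant_prob_def space_prob_algebra bind_return'')
next
  case (Suc n)
  then show ?case using assms by (simp add: invariant_prob_def bind_power_Suc del: kernel_power.simps)
qed

lemma invariant_tv:
  assumes "invariant_prob K \<mu>"
  shows "tv_le (\<Delta> ^ n) (kernel_power K n y) \<mu>"
  using bind_power_contract[OF return_in, of \<mu> n y] assms invariant_bind_power[OF assms]
  by (simp add: return_bind_power invariant_prob_def)

lemma tv_le_all_powers_eq:
  assumes M: "M \<in> space (prob_algebra borel)" and N: "N \<in> space (prob_algebra borel)"
    and tv: "\<And>n. tv_le (c * \<Delta> ^ n) M N"
  shows "M = N"
proof (rule measure_eqI)
  interpret M: prob_space M using M by (simp add: space_prob_algebra)
  interpret N: prob_space N using N by (simp add: space_prob_algebra)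
  have s: "sets M = sets borel" "sets N = sets borel" using M N by (simp_all add: space_prob_algebra)
  then show "sets M = sets N" by simp
  fix B assume "B \<in> sets M"
  then have "\<bar>measure M B - measure N B\<bar> \<le> c * \<Delta> ^ n" for n using tv_leD[OF tv] s by simp
  moreover have "(\<lambda>n. c * \<Delta> ^ n) \<longlonglongrightarrow> c * 0"
    using nonneg less_1 by (intro tendsto_mult tendsto_const LIMSEQ_realpow_zero) auto
  ultimately have "\<bar>measure M B - measure N B\<bar> \<le> c * 0"
    by (intro tendsto_lowerbound) (auto intro: always_eventually)
  then show "emeasure M B = emeasure N B" by (simp add: M.emeasure_eq_measure N.emeasure_eq_measure)
qed

text \<open>Completeness in total variation. The setwise limit \<open>p\<close> inherits finite
  additivity; countable additivity then amounts to continuity at the empty set, which follows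
  because the convergence is uniform over sets.\<close>

lemma ex_limit: "\<exists>\<mu>\<in>space (prob_algebra borel). \<forall>n. tv_le (\<Delta> ^ n) (kernel_power K n y) \<mu>"
proof -
  let ?m = "\<lambda>n. measure (kernel_power K n y)"
  define p where "p B = lim (\<lambda>n. ?m n B)" for B
  have lim0: "(\<lambda>n. \<Delta> ^ n) \<longlonglongrightarrow> 0"
    using nonneg less_1 by (intro LIMSEQ_realpow_zero) auto
  have prob: "prob_space (kernel_power K n y)" and sets: "sets (kernel_power K n y) = sets borel" for n
    using power_in[of n y] by (auto simp: space_prob_algebra)
  have conv: "(\<lambda>n. ?m n B) \<longlonglongrightarrow> p B" if B: "B \<in> sets borel" for B
    unfolding p_def convergent_LIMSEQ_iff[symmetric] Cauchy_convergent_iff[symmetric]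
  proof (rule metric_CauchyI)
    fix e :: real assume e: "0 < e"
    obtain N where N: "\<Delta> ^ N < e / 2" using real_arch_pow_inv[of "e / 2" \<Delta>] e less_1 by auto
    have close: "\<bar>?m n B - ?m N B\<bar> < e / 2" if "N \<le> n" for n
      using tv_leD[OF power_cauchy[of N "n - N" y y] B] that N by simp
    show "\<exists>M. \<forall>m\<ge>M. \<forall>n\<ge>M. dist (?m m B) (?m n B) < e"
    proof (intro exI allI impI)
      fix m n assume "N \<le> m" "N \<le> n"
      then show "dist (?m m B) (?m n B) < e"
        using close[of m] close[of n] unfolding dist_real_def by linarith
    qed
  qed
  have p_nonneg: "0 \<le> p B" if "B \<in> sets borel" for B
    by (rule LIMSEQ_le_const[OF conv[OF that]]) auto
  \<comment> \<open>Let \<open>j\<close> tend to infinity in \<open>power_cauchy\<close>.\<close>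
  have p_tv: "\<bar>?m n B - p B\<bar> \<le> \<Delta> ^ n" if B: "B \<in> sets borel" for n B
  proof (rule LIMSEQ_le_const2)
    show "(\<lambda>j. \<bar>?m n B - ?m (n + j) B\<bar>) \<longlonglongrightarrow> \<bar>?m n B - p B\<bar>"
      using LIMSEQ_ignore_initial_segment[OF conv[OF B], of n]
      by (intro tendsto_intros) (simp add: add.commute)
    show "\<exists>N. \<forall>j\<ge>N. \<bar>?m n B - ?m (n + j) B\<bar> \<le> \<Delta> ^ n"
      using tv_leD[OF power_cauchy[of n _ y y] B] by (simp add: abs_minus_commute)
  qed
  have p_add: "p (A \<union> B) = p A + p B" if "A \<in> sets borel" "B \<in> sets borel" "A \<inter> B = {}" for A B
  proof (rule LIMSEQ_unique[OF conv])
    have "?m n (A \<union> B) = ?m n A + ?m n B" for n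
      using that sets by (intro finite_measure.finite_measure_Union prob_space.finite_measure prob) auto
    then show "(\<lambda>n. ?m n (A \<union> B)) \<longlonglongrightarrow> p A + p B"
      using that by (auto intro!: tendsto_add conv)
  qed (use that in auto)
  have p_empty: "p {} = 0" by (simp add: p_def)
  define \<mu> where "\<mu> = measure_of UNIV (sets (borel :: 'e measure)) (\<lambda>B. ennreal (p B))"
  have sets_\<mu>: "sets \<mu> = sets borel"
    unfolding \<mu>_def using sets.sigma_sets_eq[of "borel :: 'e measure"] by (subst sets_measure_of) auto
  have "countably_additive (sets (borel :: 'e measure)) (\<lambda>B. ennreal (p B))"
  proof (rule sets.empty_continuous_imp_countably_additive)
    show "positive (sets borel) (\<lambda>B. ennreal (p B))" by (simp add: positive_def p_empty)
    show "additive (sets borel) (\<lambda>B. ennreal (p B))"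
      by (auto simp: additive_def p_add p_nonneg simp flip: ennreal_plus)
    fix A :: "nat \<Rightarrow> 'e set"
    assume A: "range A \<subseteq> sets borel" "decseq A" "(\<Inter>i. A i) = {}"
    have "(\<lambda>i. p (A i)) \<longlonglongrightarrow> 0"
    proof (rule LIMSEQ_I)
      fix e :: real assume e: "0 < e"
      \<comment> \<open>\<open>N\<close> is fixed before \<open>i\<close>: the \<open>N\<close>-th
        power is within \<open>e / 2\<close> of \<open>p\<close> on all Borel sets at once, and is
        itself continuous from above.\<close>
      obtain N where N: "\<Delta> ^ N < e / 2" using real_arch_pow_inv[of "e / 2" \<Delta>] e less_1 by auto
      interpret kN: prob_space "kernel_power K N y" by (rule prob)
      have "(\<lambda>i. ?m N (A i)) \<longlonglongrightarrow> ?m N (\<Inter>i. A i)"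
        using A sets by (intro kN.finite_Lim_measure_decseq) auto
      then have "(\<lambda>i. ?m N (A i)) \<longlonglongrightarrow> 0" using A by simp
      then obtain i0 where i0: "\<And>i. i0 \<le> i \<Longrightarrow> ?m N (A i) < e / 2"
        using LIMSEQ_D[of _ 0 "e/2"] e by fastforce
      have "norm (p (A i) - 0) < e" if "i0 \<le> i" for i
        using i0[OF that] p_tv[of "A i" N] A p_nonneg[of "A i"] N by (auto simp: image_subset_iff)
      then show "\<exists>i0. \<forall>i\<ge>i0. norm (p (A i) - 0) < e" by blast
    qed
    then show "(\<lambda>i. ennreal (p (A i))) \<longlonglongrightarrow> 0"
      using tendsto_ennrealI by fastforce
  qed auto
  then have em: "emeasure \<mu> B = ennreal (p B)" if "B \<in> sets borel" for B
    using that sets_\<mu> by (intro emeasure_measure_of[OF \<mu>_def]) (auto simp: positive_def p_empty)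
  have m: "measure \<mu> B = p B" if "B \<in> sets borel" for B
    using em[OF that] p_nonneg[OF that] by (simp add: measure_def)
  have "p UNIV = 1"
  proof (rule LIMSEQ_unique[OF conv])
    have "?m n UNIV = 1" for n
      using prob_space.prob_space[OF prob[of n]] sets_eq_imp_space_eq[OF sets[of n]] by simp
    then show "(\<lambda>n. ?m n UNIV) \<longlonglongrightarrow> 1" by simp
  qed simp
  then have "prob_space \<mu>"
    using em[of UNIV] sets_eq_imp_space_eq[OF sets_\<mu>] by (intro prob_spaceI) simp
  then show ?thesis
    using sets_\<mu> p_tv m by (intro bexI[of _ \<mu>]) (auto simp: tv_le_def space_prob_algebra)
qed

text \<open>One more step of \<open>K\<close> sends the powers to \<open>\<mu> \<bind> K\<close>,
  while the shifted sequence still tends to \<mu>, so the two agree. Uniqueness holds because two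
  invariant laws stay fixed while the powers of \<open>K\<close> contract their distance.\<close>

lemma ex1_invariant_prob: "\<exists>!\<mu>. invariant_prob K \<mu>"
proof (rule ex_ex1I)
  \<comment> \<open>Any starting point serves here; \<open>undefined\<close> is an arbitrary
    one.\<close>
  obtain \<mu> where \<mu>: "\<mu> \<in> space (prob_algebra borel)" "\<And>n. tv_le (\<Delta> ^ n) (kernel_power K n undefined) \<mu>"
    using ex_limit by blast
  have in': "\<mu> \<bind> K \<in> space (prob_algebra borel)"
    using \<mu>(1) by (simp add: space_prob_algebra prob_space_bind'[OF _ K_measurable] sets_bind'[OF _ K_measurable])
  have "\<mu> \<bind> K = \<mu>"
  proof (rule tv_le_all_powers_eq[OF in' \<mu>(1)])
    fix n
    have 1: "tv_le (\<Delta> * \<Delta> ^ n) (kernel_power K (Suc n) undefined) (\<mu> \<bind> K)"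
      using bind_contract[OF power_in \<mu>(1) \<mu>(2)[of n]] by simp
    have 2: "tv_le (\<Delta> * \<Delta> ^ n) (kernel_power K (Suc n) undefined) \<mu>"
      using \<mu>(2)[of "Suc n"] by simp
    show "tv_le (2 * \<Delta> * \<Delta> ^ n) (\<mu> \<bind> K) \<mu>"
      unfolding tv_le_def using tv_leD[OF 1] tv_leD[OF 2] by (fastforce simp: abs_le_iff algebra_simps)
  qed
  then show "\<exists>\<mu>. invariant_prob K \<mu>" using \<mu>(1) by (auto simp: invariant_prob_def)
next
  fix \<mu> \<nu> assume *: "invariant_prob K \<mu>" "invariant_prob K \<nu>"
  show "\<mu> = \<nu>"
  proof (rule tv_le_all_powers_eq)
    show "tv_le (1 * \<Delta> ^ n) \<mu> \<nu>" for n
      using bind_power_contract[of \<mu> \<nu> n] * by (simp add: invariant_bind_power) (simp add: invariant_prob_def)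
  qed (use * in \<open>auto simp: invariant_prob_def\<close>)
qed

lemma invariant_measure_tv: "tv_le (\<Delta> ^ n) (kernel_power K n y) (invariant_measure K)"
  unfolding invariant_measure_def by (rule invariant_tv) (rule theI'[OF ex1_invariant_prob])

text \<open>The function \<open>h\<close> is a truncated solution of the Poisson equation for \<open>indicator B\<close>;
  truncating at \<open>N\<close> leaves an error of at most \<open>\<Delta> ^ N\<close>.\<close>

lemma occupation_growth_close:
  assumes B: "B \<in> sets borel" and \<alpha>: "2 * real N * \<bar>\<alpha>\<bar> \<le> 1" "\<alpha> \<noteq> 0"
  shows "\<bar>occupation_growth K \<alpha> x B - ereal (measure (invariant_measure K) B)\<bar>
    \<le> ereal (\<Delta> ^ N + 4 * \<bar>\<alpha>\<bar> * (real N)\<^sup>2)"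
proof -
  define p where "p = measure (invariant_measure K) B"
  define q where "q k y = measure (kernel_power K k y) B" for k y
  define h where "h y = (\<Sum>k<N. q k y - p)" for y
  have q_tv: "\<bar>q k y - p\<bar> \<le> \<Delta> ^ k" for k y
    unfolding q_def p_def by (rule tv_leD[OF invariant_measure_tv B])
  have [measurable]: "q k \<in> borel_measurable borel" for k
    unfolding q_def using B by measurable
  have h_meas[measurable]: "h \<in> borel_measurable borel" unfolding h_def by measurable
  have h: "\<bar>h y\<bar> \<le> real N" for y
  proof -
    have "\<bar>h y\<bar> \<le> (\<Sum>k<N. \<bar>q k y - p\<bar>)" unfolding h_def by (rule sum_abs)
    \<comment> \<open>The crude bound 1 per term is enough, since \<open>N\<close> is fixed before
      \<alpha> tends to 0.\<close>
    also have "\<dots> \<le> (\<Sum>k<N. 1)"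
      using q_tv power_le_one[OF nonneg] less_1 by (intro sum_mono) (meson less_imp_le order_trans)
    finally show ?thesis by simp
  qed
  have poisson: "\<bar>indicator B y - p - (h y - (\<integral>z. h z \<partial>K y))\<bar> \<le> \<Delta> ^ N" for y
  proof -
    interpret Ky: prob_space "K y" using K_in[of y] by (simp add: space_prob_algebra)
    have [measurable_cong]: "sets (K y) = sets borel" using K_in[of y] by (simp add: space_prob_algebra)
    have q_int: "integrable (K y) (q k)" for k
    proof (rule Ky.integrable_const_bound[of _ 1])
      show "AE z in K y. norm (q k z) \<le> 1"
        unfolding q_def using power_in[of k] by (auto simp: space_prob_algebra prob_space.prob_le_1)
    qed measurable
    \<comment> \<open>One step of \<open>K\<close> turns \<open>q k\<close> into
      \<open>q (Suc k)\<close> and keeps the constant \<open>p\<close>, so the difference telescopes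
      to \<open>q 0 - q N\<close>. As \<open>q 0\<close> is the indicator, the defect is
      \<open>q N y - p\<close>.\<close>
    have "(\<integral>z. h z \<partial>K y) = (\<Sum>k<N. (\<integral>z. q k z \<partial>K y) - p)"
      unfolding h_def using q_int by (simp add: Ky.prob_space)
    also have "\<dots> = (\<Sum>k<N. q (Suc k) y - p)"
      unfolding q_def measure_power_Suc[OF B] ..
    finally have "h y - (\<integral>z. h z \<partial>K y) = q 0 y - q N y"
      unfolding h_def using sum_lessThan_telescope'[of "\<lambda>k. q k y" N]
      by (simp add: sum_subtractf[symmetric])
    moreover have "q 0 y = indicator B y"
      using B by (simp add: q_def measure_return)
    ultimately show ?thesis using q_tv[of N y] by (simp add: abs_minus_commute)
  qed
  show ?thesis
    using occupation_growth_bound[OF B h_meas h \<alpha> poisson] unfolding p_def .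
qed

end

section \<open>From the controlled family to single kernels\<close>

lemma uniform_ergodic_bound:
  assumes U: "a \<in> U" and "uniform_ergodic U P"
  obtains \<Delta> where "\<Delta> < 1"
    "\<And>x x' a a' B. a \<in> U \<Longrightarrow> a' \<in> U \<Longrightarrow> B \<in> sets borel \<Longrightarrow> measure (P a x) B - measure (P a' x') B \<le> \<Delta>"
proof -
  define S where "S = (SUP x. SUP x'. SUP a\<in>U. SUP a'\<in>U. SUP B\<in>sets borel.
        ereal (measure (P a x) B - measure (P a' x') B))"
  have "S < 1" using assms(2) unfolding uniform_ergodic_def S_def .
  have le: "ereal (measure (P a x) B - measure (P a' x') B) \<le> S"
    if "a \<in> U" "a' \<in> U" "B \<in> sets borel" for x x' a a' B
    unfolding S_def
    by (rule SUP_upper2[of x], simp, rule SUP_upper2[of x'], simp, rule SUP_upper2[OF that(1)],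
        rule SUP_upper2[OF that(2)], rule SUP_upper[OF that(3)])
  \<comment> \<open>The empty set rules out the value minus infinity, so the supremum is a real
    number.\<close>
  have "0 \<le> S" using le[OF U U, of "{}"] by (simp add: zero_ereal_def)
  with \<open>S < 1\<close> obtain \<Delta> where "S = ereal \<Delta>" "\<Delta> < 1" by (cases S) auto
  with le show ?thesis by (intro that[of \<Delta>]) auto
qed

theorem theorem5:
  fixes U :: "'c::topological_space set"
    and \<U> :: "('e::polish_space \<Rightarrow> 'c) set"
    and P :: "'c \<Rightarrow> 'e \<Rightarrow> 'e measure"
    and x :: 'e
  assumes "compact U"
    and "\<U> \<noteq> {}"
    and "\<And>u. u \<in> \<U> \<Longrightarrow> u \<in> borel \<rightarrow>\<^sub>M borel"
    and "\<And>u y. u \<in> \<U> \<Longrightarrow> u y \<in> U"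
    and "\<And>a. a \<in> U \<Longrightarrow> markov_kernel (P a)"
    and "\<And>u. u \<in> \<U> \<Longrightarrow> markov_kernel (controlled_kernel P u)"
    and "uniform_ergodic U P"
    and "mixing_ergodic \<U> P"
  shows "((\<lambda>\<alpha>. SUP u\<in>\<U>. SUP B\<in>sets borel.
            \<bar>occupation_growth (controlled_kernel P u) \<alpha> x B
              - ereal (measure (invariant_measure (controlled_kernel P u)) B)\<bar>)
          \<longlongrightarrow> 0) (at 0)"
proof -
  obtain u0 where u0: "u0 \<in> \<U>" using assms(2) by blast
  obtain \<Delta> where \<Delta>: "\<Delta> < 1" "\<And>x x' a a' B. a \<in> U \<Longrightarrow> a' \<in> U \<Longrightarrow> B \<in> sets borel \<Longrightarrow>
      measure (P a x) B - measure (P a' x') B \<le> \<Delta>"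
    using uniform_ergodic_bound[OF assms(4)[OF u0] assms(7)] by blast
  \<comment> \<open>(UE) is applied with the actions \<open>u x\<close> and \<open>u y\<close>; the
    same \<Delta> serves every control, which gives the uniformity in \<open>u\<close>.\<close>
  have doeblin: "doeblin (controlled_kernel P u) \<Delta>" if "u \<in> \<U>" for u
    using assms(4,6) \<Delta> that by unfold_locales (auto simp: controlled_kernel_def)
  have nonneg: "0 \<le> \<Delta>" by (rule doeblin.nonneg[OF doeblin[OF u0]])
  let ?S = "\<lambda>\<alpha>. SUP u\<in>\<U>. SUP B\<in>sets borel. \<bar>occupation_growth (controlled_kernel P u) \<alpha> x B
              - ereal (measure (invariant_measure (controlled_kernel P u)) B)\<bar>"
  \<comment> \<open>A supremum over no controls would be minus infinity; \<open>u0\<close> and the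
    empty set supply a nonnegative term.\<close>
  have S_nonneg: "0 \<le> ?S \<alpha>" for \<alpha>
    by (rule SUP_upper2[OF u0], rule SUP_upper2[of "{}"]) auto
  have S_le: "?S \<alpha> \<le> ereal (\<Delta> ^ N + 4 * \<bar>\<alpha>\<bar> * (real N)\<^sup>2)"
    if "2 * real N * \<bar>\<alpha>\<bar> \<le> 1" "\<alpha> \<noteq> 0" for \<alpha> N
    by (intro SUP_least doeblin.occupation_growth_close doeblin that)
  show ?thesis
  proof (rule order_tendstoI)
    fix b :: ereal
    assume "b < 0"
    then show "\<forall>\<^sub>F \<alpha> in at 0. b < ?S \<alpha>"
      by (intro always_eventually allI order.strict_trans2[OF _ S_nonneg])
  next
    fix b :: ereal
    assume "0 < b"
    then obtain e where "0 < ereal e" and eb: "ereal e < b" using ereal_dense2 by blast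
    then have e: "0 < e" by simp
    \<comment> \<open>\<open>N\<close> comes first and makes the truncation error small; only then
      is \<alpha> restricted in terms of this \<open>N\<close>.\<close>
    obtain N where N: "\<Delta> ^ N < e" using real_arch_pow_inv[OF e \<Delta>(1)] by blast
    have "((\<lambda>\<alpha>. 2 * real N * \<bar>\<alpha>\<bar>) \<longlongrightarrow> 2 * real N * \<bar>0\<bar>) (at 0)"
      "((\<lambda>\<alpha>. \<Delta> ^ N + 4 * \<bar>\<alpha>\<bar> * (real N)\<^sup>2) \<longlongrightarrow> \<Delta> ^ N + 4 * \<bar>0\<bar> * (real N)\<^sup>2) (at 0)"
      by (intro tendsto_intros)+
    then have "\<forall>\<^sub>F \<alpha> in at 0. 2 * real N * \<bar>\<alpha>\<bar> < 1"
      "\<forall>\<^sub>F \<alpha> in at 0. \<Delta> ^ N + 4 * \<bar>\<alpha>\<bar> * (real N)\<^sup>2 < e"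
      using N by (auto dest!: order_tendstoD(2))
    moreover have "\<forall>\<^sub>F \<alpha> in at (0::real). \<alpha> \<noteq> 0" by (rule eventually_neq_at_within)
    ultimately show "\<forall>\<^sub>F \<alpha> in at 0. ?S \<alpha> < b"
    proof eventually_elim
      case (elim \<alpha>)
      have "?S \<alpha> \<le> ereal (\<Delta> ^ N + 4 * \<bar>\<alpha>\<bar> * (real N)\<^sup>2)" using elim by (intro S_le) auto
      also have "\<dots> < ereal e" using elim by simp
      finally show ?case using eb by (rule order.strict_trans)
    qed
  qed
qed

end
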